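(* Let $H=\langle m_0,\dots,m_p,n\rangle$ be a numerical semigroup minimally generated by an almost arithmetic sequence, with associated data as in the context, and assume $W=\emptyset$. Suppose $r=1$ and $\lambda=1$. Then for every element $\gamma_k$ of $\mathrm{PF}(H)$, $k\in[1,p]$, there exists an $\mathrm{RF}$-matrix for $\gamma_k$ whose rows (indexed by $0,1,\dots,p,n$) are: (1) row $0$: $-E_0+(q-1)E_p+(v-1)E_n+E_k$; (2) row $j$ for $j\in[1,p-k]$: $-E_j+(q-1)E_p+(v-1)E_n+E_{k+j}$; (3) row $j$ for $j\in[p-k+1,p]$: $(\mu-1)E_0-E_j+(w-1)E_n+E_{k+j-p-1}$; (4) row $n$: $(\mu-1)E_0+(q-1)E_p-E_n+E_k$.
   Context: Notation: $\mathbb N=\{0,1,2,\dots\}$; $[a,b]$ is the set of integers $i$ with $a\le i\le b$. Let $p\ge1$, $d\ge1$, $m_0\ge 1$ be integers, $m_i=m_0+id$ for $i\in[0,p]$, and $n\ge1$ an integer with $\gcd(m_0,d,n)=1$. Put $H'=\sum_{i=0}^p\mathbb Nm_i$ and $H=H'+\mathbb Nn=\langle m_0,\dots,m_p,n\rangle$; assume $\{m_0,\dots,m_p,n\}$ is a minimal generating set of $H$. $\mathrm{Ap}(H,m_0)=\{h\in H: h-m_0\notin H\}$. For $t\in\mathbb N$ write $t=q_tp+r_t$ with $q_t\in\mathbb Z$, $r_t\in[1,p]$, and set $g_t=q_tm_p+m_{r_t}$ (so $q_0=-1$, $r_0=p$, $g_0=0$). Let $u=\min\{t\in\mathbb N: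 g_t\notin\mathrm{Ap}(H,m_0)\}$ and $v=\min\{b\ge1: bn\in H'\}$. It is known (Patil–Singh) that there are unique integers $z\in[0,u-1]$, $w\in[0,v-1]$, $\lambda\ge1$, $\mu\ge0$ with $g_u=\lambda m_0+wn$, $vn=\mu m_0+g_z$, and $g_{u-z}+(v-w)n=\nu m_0$, where $\nu=\lambda+\mu+1$ if $r_{u-z}<r_u$ and $\nu=\lambda+\mu$ if $r_{u-z}\ge r_u$. Set $r=r_u$, $q=q_u$, $r'=r_{u-z}$, $q'=q_{u-z}$, and $W=[u-z,u-1]\times[v-w,v-1]$ (empty iff $z=0$ or $w=0$). $\mathrm{PF}(H)$ is the set of $f\in\mathbb Z\setminus H$ with $f+h\in H$ for all $h\in H\setminus\{0\}$. An $\mathrm{RF}$-matrix for $f\in\mathrm{PF}(H)$ is a $(p+2)\times(p+2)$ integer matrix with rows and columns indexed by $0,1,\dots,p,n$ (corresponding to the generators $m_0,\dots,m_p,n$), with all diagonal entries $-1$, all off-diagonal entries in $\mathbb N$, and such that each row $(b_0,\dots,b_p,b_n)$ satisfies $\sum_{j=0}^p b_jm_j+b_nn=f$. $E_0,\dots,E_p,E_n$ denote the standard basis vectors of $\mathbb Z^{p+2}$ (coordinates indexed by $0,\dots,p,n$). Let $\gamma_k=g_{(q-1)p+r+k-1}+(v-1)n-m_0$ for $k\in[1,p]$. It is known (Patil–Sengupta) that if $W=\emptyset$, then $\mathrm{PF}(H)=\{\gamma_k: k\in[1,p]\}$ if $r=1$ and $\mathrm{PF}(H)=\{\gamma_k: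 k\in[p-r+2,p]\}$ if $r\ge2$. *)

theory Defs
  imports "Jordan_Normal_Form.Matrix"
begin

text \<open>Semigroups are subsets of \<^typ>\<open>int\<close>, since Apery sets and pseudo-Frobenius elements
  involve differences that must not be truncated.\<close>

inductive_set submonoid_generated :: "int set \<Rightarrow> int set" for X where
  zero: "0 \<in> submonoid_generated X"
| add: "x \<in> X \<Longrightarrow> s \<in> submonoid_generated X \<Longrightarrow> x + s \<in> submonoid_generated X"

definition minimal_generating_set :: "int set \<Rightarrow> int set \<Rightarrow> bool" where
  "minimal_generating_set X S \<longleftrightarrow>
     submonoid_generated X = S \<and> (\<forall>Y. Y \<subset> X \<longrightarrow> submonoid_generated Y \<noteq> S)"

definition apery :: "int set \<Rightarrow> int \<Rightarrow> int set" where
  "apery S a = {h \<in> S. h - a \<notin> S}"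

definition pseudo_frobenius :: "int set \<Rightarrow> int set" where
  "pseudo_frobenius S = {f. f \<notin> S \<and> (\<forall>h \<in> S - {0}. f + h \<in> S)}"

definition arith :: "int \<Rightarrow> int \<Rightarrow> nat \<Rightarrow> int" where
  "arith m0 d i = m0 + int i * d"

definition arith_semigroup :: "nat \<Rightarrow> int \<Rightarrow> int \<Rightarrow> int set" where
  "arith_semigroup p m0 d = {\<Sum>i = 0..p. int (c i) * arith m0 d i | c :: nat \<Rightarrow> nat. True}"

definition almost_arith_semigroup :: "nat \<Rightarrow> int \<Rightarrow> int \<Rightarrow> int \<Rightarrow> int set" where
  "almost_arith_semigroup p m0 d n = {h + int b * n | h b. h \<in> arith_semigroup p m0 d}"

text \<open>Division by \<open>p\<close> with remainder in \<open>{1..p}\<close>; the quotient of \<open>0\<close> is \<open>-1\<close>.\<close>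

definition quo :: "nat \<Rightarrow> nat \<Rightarrow> int" where
  "quo p t = (int t - 1) div int p"

definition rmd :: "nat \<Rightarrow> nat \<Rightarrow> nat" where
  "rmd p t = nat ((int t - 1) mod int p + 1)"

lemma quo_rmd_iff:
  assumes "p \<ge> 1"
  shows "a = quo p t \<and> b = rmd p t \<longleftrightarrow> int t = a * int p + int b \<and> b \<in> {1..p}"
proof
  have nn: "(int t - 1) mod int p \<ge> 0" "(int t - 1) mod int p < int p"
    using assms by simp_all
  assume "a = quo p t \<and> b = rmd p t"
  then show "int t = a * int p + int b \<and> b \<in> {1..p}"
    using nn div_mult_mod_eq[of "int t - 1" "int p"] by (auto simp: quo_def rmd_def)
next
  assume *: "int t = a * int p + int b \<and> b \<in> {1..p}"
  then have t: "int t - 1 = (int b - 1) + a * int p" by simp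
  have "(int t - 1) div int p = a" "(int t - 1) mod int p = int b - 1"
    unfolding t using * by auto
  then show "a = quo p t \<and> b = rmd p t" by (simp add: quo_def rmd_def)
qed

definition g_elt :: "nat \<Rightarrow> int \<Rightarrow> int \<Rightarrow> nat \<Rightarrow> int" where
  "g_elt p m0 d t = quo p t * arith m0 d p + arith m0 d (rmd p t)"

definition u_min :: "nat \<Rightarrow> int \<Rightarrow> int \<Rightarrow> int \<Rightarrow> nat" where
  "u_min p m0 d n = (LEAST t. g_elt p m0 d t \<notin> apery (almost_arith_semigroup p m0 d n) m0)"

definition v_min :: "nat \<Rightarrow> int \<Rightarrow> int \<Rightarrow> int \<Rightarrow> nat" where
  "v_min p m0 d n = (LEAST b. b \<ge> 1 \<and> int b * n \<in> arith_semigroup p m0 d)"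

text \<open>The conversion \<^const>\<open>nat\<close> never truncates here for \<open>k \<ge> 1\<close>: minimality of the generators
  puts \<open>arith m0 d 1, \<dots>, arith m0 d p\<close> into the Apery set, so \<open>u \<ge> p + 1\<close> and
  \<open>quo p u \<ge> 1\<close>.\<close>

definition gamma :: "nat \<Rightarrow> int \<Rightarrow> int \<Rightarrow> int \<Rightarrow> nat \<Rightarrow> int" where
  "gamma p m0 d n k =
     (let u = u_min p m0 d n; v = v_min p m0 d n in
      g_elt p m0 d (nat ((quo p u - 1) * int p + int (rmd p u) + int k - 1))
        + (int v - 1) * n - m0)"

text \<open>Rows and columns \<open>0, \<dots>, p\<close> belong to the arithmetic generators; index \<open>p + 1\<close>
  belongs to \<open>n\<close>.\<close>

definition RF_matrix :: "nat \<Rightarrow> int \<Rightarrow> int \<Rightarrow> int \<Rightarrow> int \<Rightarrow> int mat \<Rightarrow> bool" where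
  "RF_matrix p m0 d n f A \<longleftrightarrow>
     f \<in> pseudo_frobenius (almost_arith_semigroup p m0 d n) \<and>
     A \<in> carrier_mat (p + 2) (p + 2) \<and>
     (\<forall>i < p + 2. A $$ (i, i) = -1) \<and>
     (\<forall>i < p + 2. \<forall>j < p + 2. i \<noteq> j \<longrightarrow> A $$ (i, j) \<ge> 0) \<and>
     (\<forall>i < p + 2. (\<Sum>j = 0..p. A $$ (i, j) * arith m0 d j) + A $$ (i, p + 1) * n = f)"

end

theory Submission
  imports Defs
begin

text \<open>Since \<open>\<lambda> = 1\<close>, positivity forces \<open>w \<ge> 1\<close>, so \<open>W = \<emptyset>\<close> gives \<open>z = 0\<close>. The two relations become
  \<open>v n = \<mu> m\<^sub>0\<close> and \<open>q m\<^sub>p + m\<^sub>1 = m\<^sub>0 + w n\<close>; hence all four kinds of rows evaluate to \<open>\<gamma>\<^sub>k\<close>, and their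
  signs show that adding any generator to \<open>\<gamma>\<^sub>k\<close> leads into \<open>H\<close>. It remains to see
  \<open>\<gamma>\<^sub>k \<notin> H\<close>. An element of \<open>H'\<close> is the same as \<open>N m\<^sub>0 + T d\<close> with \<open>0 \<le> T \<le> p N\<close>, and by the minimality
  of \<open>u\<close> and \<open>v\<close> no \<open>t \<in> [1, u-1]\<close>, \<open>y \<in> [0, v-1]\<close> satisfy \<open>t d \<equiv> y n\<close> modulo \<open>m\<^sub>0\<close>. A representation of
  \<open>\<gamma>\<^sub>k\<close> in \<open>H\<close> would, after subtracting it from \<open>u d \<equiv> w n\<close>, produce such a pair.\<close>

section \<open>Generated submonoids and the irredundancy of minimal generators\<close>

lemma submonoid_generated_add:
  assumes "a \<in> submonoid_generated X" "b \<in> submonoid_generated X"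
  shows "a + b \<in> submonoid_generated X"
  using assms(1)
  by induction (auto simp: add.assoc assms(2) intro: submonoid_generated.add)

lemma submonoid_generated_incl: "x \<in> X \<Longrightarrow> x \<in> submonoid_generated X"
  using submonoid_generated.add[OF _ submonoid_generated.zero] by simp

lemma submonoid_generated_times:
  assumes "x \<in> submonoid_generated X"
  shows "int c * x \<in> submonoid_generated X"
  by (induction c)
    (auto simp: algebra_simps intro: submonoid_generated.zero submonoid_generated_add assms)

text \<open>If \<open>x\<close> came from the other generators, every occurrence of \<open>x\<close>
  in a sum could be expanded, and the proper subset \<open>X - {x}\<close> would already generate
  \<open>S\<close>.\<close>

lemma minimal_generating_set_irredundant:
  assumes "minimal_generating_set X S" "x \<in> X"
  shows "x \<notin> submonoid_generated (X - {x})"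
proof
  assume x: "x \<in> submonoid_generated (X - {x})"
  have "a \<in> submonoid_generated (X - {x})" if "a \<in> submonoid_generated X" for a
    using that
  proof induction
    case (add y s)
    have "y \<in> submonoid_generated (X - {x})"
      using x add(1) submonoid_generated_incl[of y "X - {x}"] by (cases "y = x") auto
    then show ?case using add submonoid_generated_add by blast
  qed (rule submonoid_generated.zero)
  moreover have "a \<in> submonoid_generated X" if "a \<in> submonoid_generated (X - {x})" for a
    using that by induction (auto intro: submonoid_generated.intros)
  ultimately have "submonoid_generated (X - {x}) = submonoid_generated X" by blast
  moreover have "X - {x} \<subset> X" using assms(2) by blast
  ultimately show False using assms(1) unfolding minimal_generating_set_def by blast
qed

section \<open>Coordinates on the arithmetic part H'\<close>

lemma arith_semigroup_add:
  assumes "a \<in> arith_semigroup p m0 d" "b \<in> arith_semigroup p m0 d"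
  shows "a + b \<in> arith_semigroup p m0 d"
proof -
  obtain c c' :: "nat \<Rightarrow> nat" where "a = (\<Sum>i = 0..p. int (c i) * arith m0 d i)"
    "b = (\<Sum>i = 0..p. int (c' i) * arith m0 d i)"
    using assms unfolding arith_semigroup_def by blast
  then have "a + b = (\<Sum>i = 0..p. int (c i + c' i) * arith m0 d i)"
    by (simp add: sum.distrib algebra_simps)
  then show ?thesis unfolding arith_semigroup_def by (auto intro!: exI[of _ "\<lambda>i. c i + c' i"])
qed

lemma arith_in_arith_semigroup:
  assumes "i \<le> p"
  shows "arith m0 d i \<in> arith_semigroup p m0 d"
proof -
  have "(\<Sum>j = 0..p. int (if j = i then 1 else 0) * arith m0 d j)
      = (\<Sum>j = 0..p. if j = i then arith m0 d j else 0)"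
    by (rule sum.cong) auto
  also have "\<dots> = arith m0 d i" using assms by simp
  finally show ?thesis unfolding arith_semigroup_def
    by (auto intro!: exI[of _ "\<lambda>j. if j = i then 1 else 0"])
qed

text \<open>\<open>N\<close> counts the summands and \<open>T\<close> adds up their indices, each at
  most \<open>p\<close>. Conversely a greedy choice works: removing one generator of index
  \<open>min T p\<close> leaves a total that fits into \<open>N - 1\<close> summands.\<close>

lemma arith_semigroup_iff:
  "x \<in> arith_semigroup p m0 d \<longleftrightarrow> (\<exists>N T :: nat. T \<le> p * N \<and> x = int N * m0 + int T * d)"
proof
  assume "x \<in> arith_semigroup p m0 d"
  then obtain c :: "nat \<Rightarrow> nat" where c: "x = (\<Sum>i = 0..p. int (c i) * arith m0 d i)"
    unfolding arith_semigroup_def by blast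
  have "(\<Sum>i = 0..p. i * c i) \<le> (\<Sum>i = 0..p. p * c i)"
    by (intro sum_mono mult_right_mono) auto
  then have "(\<Sum>i = 0..p. i * c i) \<le> p * (\<Sum>i = 0..p. c i)"
    by (simp add: sum_distrib_left)
  moreover have "x = int (\<Sum>i = 0..p. c i) * m0 + int (\<Sum>i = 0..p. i * c i) * d"
    unfolding c arith_def
    by (simp add: sum_distrib_left sum.distrib algebra_simps)
  ultimately show "\<exists>N T :: nat. T \<le> p * N \<and> x = int N * m0 + int T * d" by blast
next
  have "T \<le> p * N \<Longrightarrow> int N * m0 + int T * d \<in> arith_semigroup p m0 d" for N T
  proof (induction N arbitrary: T)
    case 0
    then show ?case unfolding arith_semigroup_def by (auto intro!: exI[of _ "\<lambda>_. 0"])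
  next
    case (Suc N)
    define i where "i = min T p"
    have "T - i \<le> p * N" using Suc.prems by (auto simp: i_def)
    from arith_semigroup_add[OF Suc.IH[OF this] arith_in_arith_semigroup[of i p]]
    have "int N * m0 + int (T - i) * d + arith m0 d i \<in> arith_semigroup p m0 d"
      by (simp add: i_def)
    moreover have "int (T - i) = int T - int i" by (simp add: i_def of_nat_diff)
    ultimately show ?case by (simp add: arith_def algebra_simps)
  qed
  then show "\<exists>N T :: nat. T \<le> p * N \<and> x = int N * m0 + int T * d \<Longrightarrow> x \<in> arith_semigroup p m0 d"
    by blast
qed

section \<open>Consequences of the minimality of u and v\<close>

lemma quo_bounds:
  assumes "p \<ge> 1"
  shows "quo p t * int p + int (rmd p t) = int t" "quo p t \<ge> -1" "int t \<le> (quo p t + 1) * int p"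
proof -
  have *: "int t = quo p t * int p + int (rmd p t) \<and> rmd p t \<in> {1..p}"
    using quo_rmd_iff[OF assms] by blast
  then show "quo p t * int p + int (rmd p t) = int t" by simp
  show "int t \<le> (quo p t + 1) * int p" using * by (simp add: algebra_simps)
  then have "(quo p t + 1) * int p \<ge> 0" by linarith
  then show "quo p t \<ge> -1" using assms by (simp add: zero_le_mult_iff)
qed

text \<open>This puts \<open>g_t\<close> into the coordinates of \<open>arith_semigroup_iff\<close>:
  the indices add up to \<open>t\<close>, and \<open>quo p t + 1\<close> is the least number of
  summands allowing that total.\<close>

lemma g_elt_eq:
  assumes "p \<ge> 1"
  shows "g_elt p m0 d t = (quo p t + 1) * m0 + int t * d"
proof -
  have "g_elt p m0 d t = (quo p t + 1) * m0 + (quo p t * int p + int (rmd p t)) * d"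
    by (simp add: g_elt_def arith_def algebra_simps)
  then show ?thesis using quo_bounds(1)[OF assms] by simp
qed

text \<open>The congruence gives \<open>g_t = \<kappa> * m0 + y * n\<close>, and the sign of
  \<kappa> decides. For positive \<kappa>, \<open>g_t - m0\<close> lies in H, against the minimality
  of u. Otherwise \<open>y * n\<close> lies in H', so minimality of v leaves only
  \<open>y = 0\<close>, which fails because \<open>t * d > 0\<close>.\<close>

lemma no_congruence_below_u_v:
  assumes "p \<ge> 1" "d \<ge> 1" "m0 \<ge> 1"
    and t: "0 < t" "t < u_min p m0 d n" and y: "y < v_min p m0 d n"
  shows "\<not> m0 dvd int t * d - int y * n"
proof
  assume "m0 dvd int t * d - int y * n"
  then obtain x where x: "int t * d = m0 * x + int y * n" by (auto simp: dvd_def algebra_simps)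
  define \<kappa> where "\<kappa> = quo p t + 1 + x"
  note qb = quo_bounds[OF assms(1), of t]
  have g: "(quo p t + 1) * m0 + int t * d = \<kappa> * m0 + int y * n"
    using x by (simp add: \<kappa>_def algebra_simps)
  show False
  proof (cases "\<kappa> \<ge> 1")
    case True
    have "g_elt p m0 d t - m0 = int (nat (\<kappa> - 1)) * m0 + int 0 * d + int y * n"
      using True g by (simp add: g_elt_eq[OF assms(1)] algebra_simps)
    moreover have "int (nat (\<kappa> - 1)) * m0 + int 0 * d \<in> arith_semigroup p m0 d"
      unfolding arith_semigroup_iff by blast
    ultimately have "g_elt p m0 d t - m0 \<in> almost_arith_semigroup p m0 d n"
      unfolding almost_arith_semigroup_def by blast
    moreover have "g_elt p m0 d t \<in> apery (almost_arith_semigroup p m0 d n) m0"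
      using not_less_Least t(2) unfolding u_min_def by blast
    ultimately show False by (simp add: apery_def)
  next
    case False
    define N where "N = nat (quo p t + 1 - \<kappa>)"
    have N: "int N = quo p t + 1 - \<kappa>" using False qb by (simp add: N_def)
    \<comment> \<open>As \<kappa> is not positive, \<open>N\<close> is at least
      \<open>quo p t + 1\<close>, and that many summands suffice for index total
      \<open>t\<close>.\<close>
    have "int t \<le> int N * int p"
      using False qb(3) mult_right_mono[of "quo p t + 1" "int N" "int p"] N by simp
    then have "t \<le> p * N" by (simp only: of_nat_mult[symmetric] of_nat_le_iff mult.commute)
    moreover have yn: "int y * n = int N * m0 + int t * d"
      using g unfolding N by (simp add: algebra_simps)
    ultimately have "int y * n \<in> arith_semigroup p m0 d" unfolding arith_semigroup_iff by blast
    then have "y = 0" using not_less_Least y unfolding v_min_def by force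
    moreover have "int N * m0 + int t * d > 0"
      using assms(2,3) t(1) by (intro add_nonneg_pos) auto
    ultimately show False using yn by simp
  qed
qed

lemma gamma_not_in_semigroup:
  fixes p s w :: nat and m0 d n q mu :: int
  assumes "p \<ge> 1" "d \<ge> 1" "m0 \<ge> 1" "mu \<ge> 0"
    and v: "int (v_min p m0 d n) * n = mu * m0" "v_min p m0 d n \<ge> 1"
    and u: "m0 dvd int (u_min p m0 d n) * d - int w * n"
    and s: "s < u_min p m0 d n" "int s > (q - 1) * int p"
  shows "q * m0 + int s * d + (int (v_min p m0 d n) - 1) * n - m0
    \<notin> almost_arith_semigroup p m0 d n"
proof
  let ?u = "u_min p m0 d n" and ?v = "v_min p m0 d n"
  assume "q * m0 + int s * d + (int ?v - 1) * n - m0 \<in> almost_arith_semigroup p m0 d n"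
  then obtain N0 T b0 where *: "T \<le> p * N0"
    "q * m0 + int s * d + (int ?v - 1) * n - m0 = int N0 * m0 + int T * d + int b0 * n"
    unfolding almost_arith_semigroup_def arith_semigroup_iff by blast
  \<comment> \<open>The relation \<open>v * n = mu * m0\<close> trades each block of
    \<open>v\<close> copies of \<open>n\<close> for \<open>mu\<close> copies of \<open>m0\<close>,
    so the coefficient of \<open>n\<close> may be taken below \<open>v\<close>.\<close>
  define b where "b = b0 mod ?v"
  define N where "N = N0 + (b0 div ?v) * nat mu"
  have b: "b < ?v" using v(2) by (simp add: b_def)
  have "int b0 = int (b0 div ?v) * int ?v + int b"
    unfolding b_def by (metis div_mult_mod_eq of_nat_add of_nat_mult)
  then have "int b0 * n = int (b0 div ?v) * (int ?v * n) + int b * n"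
    by (simp add: algebra_simps)
  then have b0: "int N0 * m0 + int b0 * n = int N * m0 + int b * n"
    unfolding v(1) N_def using assms(4) by (simp add: algebra_simps)
  have "T \<le> p * N" using *(1) by (simp add: N_def algebra_simps)
  then have TN: "int T \<le> int p * int N" by (simp only: of_nat_mult[symmetric] of_nat_le_iff)
  define e where "e = ?v - 1 - b"
  have e: "int e = int ?v - 1 - int b" "e < ?v" using b by (auto simp: e_def of_nat_diff)
  have eq: "q * m0 + int s * d + int e * n = (1 + int N) * m0 + int T * d"
    unfolding e(1) using *(2) b0 by (simp add: algebra_simps)
  show False
  proof (cases "T \<ge> s")
    case True
    \<comment> \<open>After cancelling \<open>s * d\<close> and \<open>q * m0\<close>,
      \<open>e * n\<close> has \<open>N + 1 - q\<close> summands and index total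
      \<open>T - s\<close>. The bound \<open>s > (q - 1) * p\<close> makes this an admissible pair
      for H' with a positive number of summands, against the minimality of v.\<close>
    have "int p * (int N + 1 - q) > int T - int s" using TN s(2) by (simp add: algebra_simps)
    moreover from this have "int p * (int N + 1 - q) > 0" using True by linarith
    then have pos: "int N + 1 - q > 0" by (simp add: zero_less_mult_iff)
    ultimately have "int (T - s) \<le> int (p * nat (int N + 1 - q))"
      using True by (simp add: of_nat_diff)
    then have "T - s \<le> p * nat (int N + 1 - q)" by (simp only: of_nat_le_iff)
    moreover have en: "int e * n = int (nat (int N + 1 - q)) * m0 + int (T - s) * d"
      using eq pos True by (simp add: of_nat_diff algebra_simps)
    ultimately have "int e * n \<in> arith_semigroup p m0 d" unfolding arith_semigroup_iff by blast
    then have "e = 0" using not_less_Least e(2) unfolding v_min_def by force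
    moreover have "int (nat (int N + 1 - q)) * m0 + int (T - s) * d > 0"
      using assms(2,3) pos by (intro add_pos_nonneg) auto
    ultimately show False using en by simp
  next
    case False
    \<comment> \<open>Here \<open>0 < s - T \<le> s < u\<close>, so \<open>t\<close> stays strictly
      between 0 and \<open>u\<close>. Modulo \<open>m0\<close>, \<open>(s - T) * d\<close> is
      \<open>- e * n\<close> and \<open>u * d\<close> is \<open>w * n\<close>, hence
      \<open>t * d\<close> is \<open>(w + e) * n\<close>; reducing \<open>w + e\<close> modulo
      \<open>v\<close> gives the forbidden pair.\<close>
    define t where "t = ?u - (s - T)"
    have t: "0 < t" "t < ?u" "int t = int ?u - int s + int T"
      using False s(1) by (auto simp: t_def of_nat_diff)
    define y where "y = (w + e) mod ?v"
    have y: "y < ?v" using v(2) by (simp add: y_def)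
    have "int (w + e) = int ((w + e) div ?v) * int ?v + int y"
      unfolding y_def by (metis div_mult_mod_eq of_nat_add of_nat_mult)
    then have "int (w + e) * n = int ((w + e) div ?v) * (int ?v * n) + int y * n"
      by (simp add: algebra_simps)
    then have we: "int w * n + int e * n = int ((w + e) div ?v) * mu * m0 + int y * n"
      unfolding v(1) by (simp add: algebra_simps)
    obtain x where x: "int ?u * d - int w * n = m0 * x" using u by (auto simp: dvd_def)
    have "int t * d - int y * n
        = m0 * (x + int ((w + e) div ?v) * mu + q - 1 - int N)"
      using we eq x unfolding t(3) by (simp add: algebra_simps)
    then show False using no_congruence_below_u_v[OF assms(1-3) t(1,2) y] by simp
  qed
qed

section \<open>Pseudo-Frobenius elements and RF-matrices from rows\<close>

lemma pseudo_frobenius_submonoid_generatedI: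
  assumes "f \<notin> submonoid_generated X" "\<And>x. x \<in> X \<Longrightarrow> f + x \<in> submonoid_generated X"
  shows "f \<in> pseudo_frobenius (submonoid_generated X)"
proof -
  have "h = 0 \<or> f + h \<in> submonoid_generated X" if "h \<in> submonoid_generated X" for h
    using that
  proof cases
    \<comment> \<open>A nonzero \<open>h\<close> splits off a generator \<open>x\<close>, so
      \<open>f + h\<close> is \<open>f + x\<close> plus an element of the submonoid; testing
      generators is enough.\<close>
    case (add x s)
    then show ?thesis
      using submonoid_generated_add[OF assms(2)[of x], of s] by (simp add: add.assoc)
  qed simp
  then show ?thesis using assms(1) by (auto simp: pseudo_frobenius_def)
qed

text \<open>Listing all generators in one vector, with \<open>n\<close> at index
  \<open>p + 1\<close>, turns the value of a row into a scalar product.\<close>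

definition gen :: "nat \<Rightarrow> int \<Rightarrow> int \<Rightarrow> int \<Rightarrow> nat \<Rightarrow> int" where
  "gen p m0 d n i = (if i \<le> p then arith m0 d i else n)"

lemma gen_image: "gen p m0 d n ` {..<p + 2} = arith m0 d ` {0..p} \<union> {n}"
proof -
  have "{..<p + 2} = {0..p} \<union> {p + 1}" by auto
  then show ?thesis by (auto simp: gen_def image_iff)
qed

lemma scalar_prod_gen:
  assumes "x \<in> carrier_vec (p + 2)"
  shows "x \<bullet> vec (p + 2) (gen p m0 d n) = (\<Sum>j = 0..p. x $ j * arith m0 d j) + x $ (p + 1) * n"
proof -
  have "{0..<p + 2} = insert (p + 1) {0..p}" by auto
  then show ?thesis
    using assms by (simp add: scalar_prod_def gen_def)
qed

lemma unit_vec_scalar_prod_gen: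
  assumes "i < p + 2"
  shows "unit_vec (p + 2) i \<bullet> vec (p + 2) (gen p m0 d n) = gen p m0 d n i"
  using assms by (simp add: scalar_prod_left_unit)

lemma scalar_prod_gen_in_semigroup:
  assumes x: "x \<in> carrier_vec (p + 2)" and nonneg: "\<And>j. j < p + 2 \<Longrightarrow> x $ j \<ge> 0"
  shows "x \<bullet> vec (p + 2) (gen p m0 d n) \<in> almost_arith_semigroup p m0 d n"
proof -
  have "(\<Sum>j = 0..p. x $ j * arith m0 d j) = (\<Sum>j = 0..p. int (nat (x $ j)) * arith m0 d j)"
    using nonneg by (intro sum.cong) auto
  then have "(\<Sum>j = 0..p. x $ j * arith m0 d j) \<in> arith_semigroup p m0 d"
    unfolding arith_semigroup_def by (auto simp del: int_nat_eq intro!: exI[of _ "\<lambda>j. nat (x $ j)"])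
  moreover have "x $ (p + 1) * n = int (nat (x $ (p + 1))) * n" using nonneg by simp
  ultimately show ?thesis
    unfolding scalar_prod_gen[OF x] almost_arith_semigroup_def mem_Collect_eq by metis
qed

text \<open>The rows themselves prove that \<open>f\<close> is pseudo-Frobenius: adding the unit
  vector of index \<open>i\<close> to row \<open>i\<close> cancels the diagonal -1, so
  \<open>f\<close> plus the \<open>i\<close>-th generator has nonnegative coefficients.\<close>

lemma RF_matrix_of_rowsI:
  assumes H: "submonoid_generated (arith m0 d ` {0..p} \<union> {n}) = almost_arith_semigroup p m0 d n"
    and f: "f \<notin> almost_arith_semigroup p m0 d n"
    and carrier: "\<And>i. i < p + 2 \<Longrightarrow> R i \<in> carrier_vec (p + 2)"
    and diag: "\<And>i. i < p + 2 \<Longrightarrow> R i $ i = -1"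
    and offdiag: "\<And>i j. i < p + 2 \<Longrightarrow> j < p + 2 \<Longrightarrow> i \<noteq> j \<Longrightarrow> R i $ j \<ge> 0"
    and rows: "\<And>i. i < p + 2 \<Longrightarrow> R i \<bullet> vec (p + 2) (gen p m0 d n) = f"
  shows "RF_matrix p m0 d n f (mat (p + 2) (p + 2) (\<lambda>(i, j). R i $ j))"
proof -
  have "f + x \<in> almost_arith_semigroup p m0 d n" if "x \<in> arith m0 d ` {0..p} \<union> {n}" for x
  proof -
    obtain i where i: "i < p + 2" "x = gen p m0 d n i"
      using \<open>x \<in> _\<close> unfolding gen_image[symmetric] by auto
    have "(R i + unit_vec (p + 2) i) \<bullet> vec (p + 2) (gen p m0 d n) = f + x"
      using carrier[OF i(1)] rows[OF i(1)] i
      by (simp add: add_scalar_prod_distrib[where n = "p + 2"] unit_vec_scalar_prod_gen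
          del: add_2_eq_Suc')
    moreover have "(R i + unit_vec (p + 2) i) \<bullet> vec (p + 2) (gen p m0 d n)
        \<in> almost_arith_semigroup p m0 d n"
      using carrier[OF i(1)] i(1) diag[OF i(1)] offdiag[OF i(1)]
      by (intro scalar_prod_gen_in_semigroup) (auto simp: unit_vec_def)
    ultimately show ?thesis by simp
  qed
  then have "f \<in> pseudo_frobenius (almost_arith_semigroup p m0 d n)"
    using f pseudo_frobenius_submonoid_generatedI[of f "arith m0 d ` {0..p} \<union> {n}"]
    unfolding H by blast
  moreover have "(\<Sum>j = 0..p. R i $ j * arith m0 d j) + R i $ (p + 1) * n = f" if "i < p + 2" for i
    using rows[OF that] scalar_prod_gen[OF carrier[OF that]] by simp
  ultimately show ?thesis
    unfolding RF_matrix_def using diag offdiag by auto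
qed

section \<open>The rows for \<open>r = 1\<close> and \<open>lam = 1\<close>\<close>

theorem proposition3p2:
  fixes p u v z w r :: nat
    and m0 d n q lam mu nu :: int
    and E :: "nat \<Rightarrow> int vec"
  assumes "p \<ge> 1" and "d \<ge> 1" and "m0 \<ge> 1" and "n \<ge> 1"
    and "gcd m0 (gcd d n) = 1"
    and "minimal_generating_set (arith m0 d ` {0..p} \<union> {n}) (almost_arith_semigroup p m0 d n)"
    and "u = u_min p m0 d n" and "v = v_min p m0 d n"
    and "z \<in> {0..u - 1}" and "w \<in> {0..v - 1}" and "lam \<ge> 1" and "mu \<ge> 0"
    and "g_elt p m0 d u = lam * m0 + int w * n"
    and "int v * n = mu * m0 + g_elt p m0 d z"
    and "nu = (if rmd p (u - z) < rmd p u then lam + mu + 1 else lam + mu)"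
    and "g_elt p m0 d (u - z) + int (v - w) * n = nu * m0"
    and "q = quo p u" and "r = rmd p u"
    and W_empty: "{u - z..u - 1} \<times> {v - w..v - 1} = {}"
    and "r = 1" and "lam = 1"
    and E_def: "\<And>i. E i = unit_vec (p + 2) i"
  shows "\<forall>k \<in> {1..p}. \<exists>A. RF_matrix p m0 d n (gamma p m0 d n k) A \<and>
      row A 0 = - E 0 + (q - 1) \<cdot>\<^sub>v E p + (int v - 1) \<cdot>\<^sub>v E (p + 1) + E k \<and>
      (\<forall>j \<in> {1..p - k}.
        row A j = - E j + (q - 1) \<cdot>\<^sub>v E p + (int v - 1) \<cdot>\<^sub>v E (p + 1) + E (k + j)) \<and>
      (\<forall>j \<in> {p - k + 1..p}.
        row A j = (mu - 1) \<cdot>\<^sub>v E 0 - E j + (int w - 1) \<cdot>\<^sub>v E (p + 1) + E (k + j - p - 1)) \<and>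
      row A (p + 1) = (mu - 1) \<cdot>\<^sub>v E 0 + (q - 1) \<cdot>\<^sub>v E p - E (p + 1) + E k"
proof
  fix k assume k: "k \<in> {1..p}"
  define G where "G = vec (p + 2) (gen p m0 d n)"
  have G: "G \<in> carrier_vec (p + 2)" by (simp add: G_def)
  note p = \<open>p \<ge> 1\<close> and d = \<open>d \<ge> 1\<close> and m0 = \<open>m0 \<ge> 1\<close> and n = \<open>n \<ge> 1\<close>
  have u_eq: "int u = q * int p + 1"
    using quo_bounds(1)[OF p, of u] assms(17,18,20) by simp
  have gu: "(q + 1) * m0 + int u * d = m0 + int w * n"
    using assms(13,17,21) by (simp add: g_elt_eq[OF p])
  have q0: "q \<ge> -1" using quo_bounds(2)[OF p] assms(17) by simp
  have "q \<noteq> -1"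
  proof
    assume "q = -1"
    then have "u = 0" using u_eq p by simp
    then have "m0 + int w * n = 0" using gu \<open>q = -1\<close> by simp
    moreover have "int w * n \<ge> 0" using n by simp
    ultimately show False using m0 by linarith
  qed
  then have q0: "q \<ge> 0" using q0 by simp
  then have u1: "u \<ge> 1" using u_eq by (smt (verit) mult_nonneg_nonneg of_nat_0_le_iff of_nat_1 of_nat_le_iff)
  \<comment> \<open>Cancelling the single \<open>m0\<close> allowed by \<open>lam = 1\<close> leaves
    \<open>q * m0 + u * d = w * n\<close>, whose left side is positive.\<close>
  have "w \<noteq> 0"
  proof
    assume "w = 0"
    moreover have "q * m0 \<ge> 0" "int u * d > 0" using q0 m0 u1 d by simp_all
    ultimately show False using gu by (simp add: algebra_simps)
  qed
  then have w: "w \<ge> 1" "w < v" using assms(10) by auto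
  have "v - w \<in> {v - w..v - 1}" using w by auto
  then have "{u - z..u - 1} = {}" using W_empty by blast
  then have z: "z = 0" using u1 by auto
  \<comment> \<open>At \<open>t = 0\<close> the quotient is -1 and the remainder \<open>p\<close>,
    so \<open>g_0 = 0\<close>.\<close>
  have vn: "int v * n = mu * m0"
    using assms(14) quo_rmd_iff[OF p, of "-1" 0 p] p by (simp add: z g_elt_eq[OF p])
  have "mu * m0 > 0" using vn[symmetric] w n by simp
  then have mu: "mu \<ge> 1" using m0 by (simp add: zero_less_mult_iff)
  \<comment> \<open>For \<open>q = 0\<close> one has \<open>u = 1\<close> and
    \<open>m_1 = m0 + w * n\<close>, which makes the generator \<open>m_1\<close> redundant.\<close>
  have "q \<noteq> 0"
  proof
    assume "q = 0"
    then have m1: "arith m0 d 1 = m0 + int w * n" using gu u_eq by (simp add: arith_def)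
    let ?X = "arith m0 d ` {0..p} \<union> {n}"
    have "int w * n \<ge> n" using w n by simp
    then have "n \<noteq> arith m0 d 1" using m1 m0 by linarith
    moreover have "m0 \<noteq> arith m0 d 1" using d by (simp add: arith_def)
    moreover have "m0 \<in> ?X" by (auto simp: arith_def image_iff intro!: bexI[of _ 0])
    ultimately have "m0 + int w * n \<in> submonoid_generated (?X - {arith m0 d 1})"
      by (intro submonoid_generated_add submonoid_generated_times submonoid_generated_incl) auto
    moreover have "arith m0 d 1 \<in> ?X" using p by auto
    ultimately show False
      using minimal_generating_set_irredundant[OF assms(6)] m1 by auto
  qed
  then have q: "q \<ge> 1" using q0 by simp

  \<comment> \<open>This is the index of \<open>g\<close> in \<gamma>\<open>_k\<close>: with
    \<open>r = 1\<close> the summands +1 and -1 cancel, and \<open>q \<ge> 1\<close> keeps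
    \<open>nat\<close> from truncating.\<close>
  define s where "s = nat ((q - 1) * int p + int k)"
  have s: "int s = (q - 1) * int p + int k" using q by (simp add: s_def)
  have quo_s: "quo p s = q - 1" using quo_rmd_iff[OF p, of "q - 1" s k] s k by simp
  have gamma: "gamma p m0 d n k = q * m0 + int s * d + (int v - 1) * n - m0"
    unfolding gamma_def Let_def assms(7,8)[symmetric] assms(17,18)[symmetric] \<open>r = 1\<close>
    using quo_s by (simp add: s_def[symmetric] g_elt_eq[OF p])
  have "s < u" using s u_eq k by (simp add: algebra_simps flip: of_nat_less_iff)
  moreover have "m0 dvd int u * d - int w * n"
  proof
    show "int u * d - int w * n = m0 * (- q)" using gu by (simp add: algebra_simps)
  qed
  ultimately have notin: "gamma p m0 d n k \<notin> almost_arith_semigroup p m0 d n"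
    unfolding gamma using gamma_not_in_semigroup[OF p d m0 \<open>mu \<ge> 0\<close>, of n w s q] vn w s k
    by (simp add: assms(7,8)[symmetric])

  define R where "R i =
    (if i = 0 then - E 0 + (q - 1) \<cdot>\<^sub>v E p + (int v - 1) \<cdot>\<^sub>v E (p + 1) + E k
     else if i \<le> p - k then - E i + (q - 1) \<cdot>\<^sub>v E p + (int v - 1) \<cdot>\<^sub>v E (p + 1) + E (k + i)
     else if i \<le> p then (mu - 1) \<cdot>\<^sub>v E 0 - E i + (int w - 1) \<cdot>\<^sub>v E (p + 1) + E (k + i - p - 1)
     else (mu - 1) \<cdot>\<^sub>v E 0 + (q - 1) \<cdot>\<^sub>v E p - E (p + 1) + E k)" for i
  have E: "E i \<in> carrier_vec (p + 2)" for i by (simp add: E_def)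
  have dimE: "dim_vec (E i) = p + 2" for i by (simp add: E_def)
  have Ej: "E i $ j = (if j = i then 1 else 0)" if "j < p + 2" for i j
    using that by (simp add: E_def unit_vec_def)
  have EG: "E i \<bullet> G = gen p m0 d n i" if "i < p + 2" for i
    using that unfolding E_def G_def by (rule unit_vec_scalar_prod_gen)
  have carrier: "R i \<in> carrier_vec (p + 2)" if "i < p + 2" for i
    unfolding R_def using E by auto
  note dist = add_scalar_prod_distrib[where n = "p + 2"] minus_scalar_prod_distrib[where n = "p + 2"]
    smult_scalar_prod_distrib[where n = "p + 2"] uminus_scalar_prod[where n = "p + 2"]
  have rows: "R i \<bullet> G = gamma p m0 d n k" if i: "i < p + 2" for i
  proof -
    \<comment> \<open>The equation is multiplied by \<open>d\<close> to match the product
      \<open>int u * d\<close> in \<open>gu\<close>.\<close>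
    have ud: "int u * d = (q * int p + 1) * d" using u_eq by simp
    consider "i = 0" | "i \<noteq> 0" "i \<le> p - k" | "i > p - k" "i \<le> p" | "i = p + 1" using i by linarith
    then show ?thesis
    proof cases
      case 1
      then show ?thesis using k E G unfolding R_def gamma
        by (simp add: dist EG gen_def arith_def s algebra_simps del: add_2_eq_Suc')
    next
      \<comment> \<open>This is row 0 with \<open>m_k - m_0\<close> rewritten as
        \<open>m_(k+i) - m_i\<close>.\<close>
      case 2
      then have "k + i \<le> p" "i \<le> p" using k by auto
      then show ?thesis using 2 k E G unfolding R_def gamma
        by (simp add: dist EG gen_def arith_def s algebra_simps del: add_2_eq_Suc')
    next
      \<comment> \<open>Now \<open>k + i\<close> exceeds \<open>p\<close>, so the index wraps around
        to \<open>l\<close>: \<open>gu\<close> replaces \<open>w * n\<close> by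
        \<open>q * m_p + m_1 - m_0\<close>, and \<open>vn\<close> replaces \<open>mu * m0\<close> by
        \<open>v * n\<close>.\<close>
      case 3
      define l where "l = k + i - p - 1"
      have "l \<le> p" "int l = int k + int i - int p - 1" using 3 k by (auto simp: l_def)
      then have l: "l \<le> p" "int l * d = (int k + int i - int p - 1) * d" by simp_all
      show ?thesis using 3 l k E G gu vn ud unfolding R_def gamma l_def[symmetric]
        by (simp add: dist EG gen_def arith_def s algebra_simps del: add_2_eq_Suc')
    next
      case 4
      then show ?thesis using k E G vn unfolding R_def gamma
        by (simp add: dist EG gen_def arith_def s algebra_simps del: add_2_eq_Suc')
    qed
  qed
  \<comment> \<open>No positive unit vector meets the diagonal: \<open>k \<ge> 1\<close> gives
    \<open>k + i > i\<close> and excludes \<open>i = p\<close> from the second kind of row, while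
    \<open>k \<le> p\<close> gives \<open>k + i - p - 1 < i\<close> in the third.\<close>
  have diag: "R i $ i = -1" if "i < p + 2" for i
    using that k by (auto simp: R_def dimE Ej)
  have offdiag: "R i $ j \<ge> 0" if "i < p + 2" "j < p + 2" "i \<noteq> j" for i j
    using that k q w mu by (auto simp: R_def dimE Ej)
  define A where "A = mat (p + 2) (p + 2) (\<lambda>(i, j). R i $ j)"
  have "submonoid_generated (arith m0 d ` {0..p} \<union> {n}) = almost_arith_semigroup p m0 d n"
    using assms(6) by (simp add: minimal_generating_set_def)
  then have "RF_matrix p m0 d n (gamma p m0 d n k) A"
    unfolding A_def using notin carrier diag offdiag rows[unfolded G_def]
    by (rule RF_matrix_of_rowsI)
  moreover have "row A i = R i" if "i < p + 2" for i
    using that carrier[OF that] by (intro eq_vecI) (auto simp: A_def)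
  ultimately show "\<exists>A. RF_matrix p m0 d n (gamma p m0 d n k) A \<and>
      row A 0 = - E 0 + (q - 1) \<cdot>\<^sub>v E p + (int v - 1) \<cdot>\<^sub>v E (p + 1) + E k \<and>
      (\<forall>j \<in> {1..p - k}.
        row A j = - E j + (q - 1) \<cdot>\<^sub>v E p + (int v - 1) \<cdot>\<^sub>v E (p + 1) + E (k + j)) \<and>
      (\<forall>j \<in> {p - k + 1..p}.
        row A j = (mu - 1) \<cdot>\<^sub>v E 0 - E j + (int w - 1) \<cdot>\<^sub>v E (p + 1) + E (k + j - p - 1)) \<and>
      row A (p + 1) = (mu - 1) \<cdot>\<^sub>v E 0 + (q - 1) \<cdot>\<^sub>v E p - E (p + 1) + E k"
    by (intro exI[of _ A]) (auto simp: R_def)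
qed

end
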